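(* Let $a_{7,n}, b_{6,n}, c_{19,n}\in\mathbb{R}$ and let $d_{r,n,low}\le d_{r,n,up}$ be real numbers. Let $f(d_{r,n}) = a_{7,n}d_{r,n}^2+b_{6,n}d_{r,n}-c_{19,n}$, and, when $a_{7,n}\neq 0$, let $d_{r,n,sym}=-\frac{b_{6,n}}{2a_{7,n}}$ denote the axis of symmetry of $f$. Consider the problem $$\min_{d_{r,n}}\ f(d_{r,n})\quad\text{subject to}\quad d_{r,n}\in[d_{r,n,low},\,d_{r,n,up}].$$ Then an optimal solution $d_{r,n}^{\star}$ of this problem is obtained as follows. (Case I) If $a_{7,n}=0$, then $$d_{r,n}^{\star}=\begin{cases} d_{r,n,low}, & b_{6,n}>0,\\ d_{r,n,up}, & b_{6,n}<0,\\ \text{an arbitrary value in }[d_{r,n,low},d_{r,n,up}], & b_{6,n}=0.\end{cases}$$ (Case II) If $a_{7,n}>0$, then $$d_{r,n}^{\star}=\begin{cases} d_{r,n,low}, & d_{r,n,sym}<d_{r,n,low},\\ d_{r,n,up}, & d_{r,n,sym}>d_{r,n,up},\\ d_{r,n,sym}, & d_{r,n,low}\le d_{r,n,sym}\le d_{r,n,up}.\end{cases}$$ (Case III) If $a_{7,n}<0$, then $$d_{r,n}^{\star}=\begin{cases} d_{r,n,up}, & d_{r,n,sym}<d_{r,n,low},\\ d_{r,n,low}, & d_{r,n,sym}>d_{r,n,up},\\ \text{an element of }\{d_{r,n,low},d_{r,n,up}\}\text{ at which } f \text{ is smallest}, & d_{r,n,low}\le d_{r,n,sym}\le d_{r,n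,up}.\end{cases}$$
   Context: All quantities are real scalars; the subscripts are only names. An optimal solution means a point of the interval $[d_{r,n,low},d_{r,n,up}]$ at which $f$ attains its minimum over that interval. In the application, $d_{r,n}$ is the position of the $n$-th receive antenna on a line segment, and $[d_{r,n,low},d_{r,n,up}]$ is its (nonempty) set of feasible positions when all other variables are fixed. *)

theory Defs
  imports Complex_Main
begin

(* The library's is_arg_min takes a predicate; on a linear order it says that
   d lies in S and that f d \<le> f x for all x in S. *)
abbreviation optimal_solution :: "(real \<Rightarrow> real) \<Rightarrow> real set \<Rightarrow> real \<Rightarrow> bool" where
  "optimal_solution f S d \<equiv> is_arg_min f (\<lambda>x. x \<in> S) d"

definition objective :: "real \<Rightarrow> real \<Rightarrow> real \<Rightarrow> real \<Rightarrow> real" where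
  "objective a b c d = a * d\<^sup>2 + b * d - c"

(* Meaningful only for a \<noteq> 0; for a = 0 it is 0 by the convention on division. *)
definition axis_of_symmetry :: "real \<Rightarrow> real \<Rightarrow> real" where
  "axis_of_symmetry a b = - (b / (2 * a))"

end

(* Completing the square shows that comparing objective values amounts to comparing
   distances to the axis of symmetry: an optimal point is one nearest to the axis if
   a > 0 and one farthest from it if a < 0. *)
theory Submission
  imports Defs
begin

text \<open>The remainder from completing the square, -c - b^2/(4a), is the same at both points and
  cancels.\<close>

lemma objective_diff:
  assumes "a \<noteq> 0"
  shows "objective a b c y - objective a b c x =
    a * ((y - axis_of_symmetry a b)\<^sup>2 - (x - axis_of_symmetry a b)\<^sup>2)"
  using assms by (simp add: objective_def axis_of_symmetry_def power2_eq_square field_simps)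

text \<open>Serves as a rewrite rule: optimality becomes a comparison of absolute values of linear
  terms.\<close>

lemma objective_le_iff_pos:
  assumes "a > 0"
  shows "objective a b c x \<le> objective a b c y \<longleftrightarrow>
    \<bar>x - axis_of_symmetry a b\<bar> \<le> \<bar>y - axis_of_symmetry a b\<bar>"
proof -
  have "objective a b c x \<le> objective a b c y \<longleftrightarrow>
      0 \<le> a * ((y - axis_of_symmetry a b)\<^sup>2 - (x - axis_of_symmetry a b)\<^sup>2)"
    using objective_diff[of a b c y x] assms by linarith
  with assms show ?thesis
    by (simp add: zero_le_mult_iff abs_le_square_iff)
qed

text \<open>The negative factor \<open>a\<close> flips the sign of the difference of squares, hence
  the swapped sides.\<close>

lemma objective_le_iff_neg:
  assumes "a < 0"
  shows "objective a b c x \<le> objective a b c y \<longleftrightarrow>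
    \<bar>y - axis_of_symmetry a b\<bar> \<le> \<bar>x - axis_of_symmetry a b\<bar>"
proof -
  have "objective a b c x \<le> objective a b c y \<longleftrightarrow>
      0 \<le> a * ((y - axis_of_symmetry a b)\<^sup>2 - (x - axis_of_symmetry a b)\<^sup>2)"
    using objective_diff[of a b c y x] assms by linarith
  with assms show ?thesis
    by (simp add: zero_le_mult_iff abs_le_square_iff)
qed

theorem theorem1:
  fixes a b c low up :: real
  assumes "low \<le> up"
  shows "let f = objective a b c;
             sym = axis_of_symmetry a b;
             optimal = optimal_solution f {low..up}
         in
           (a = 0 \<longrightarrow>
              (b > 0 \<longrightarrow> optimal low) \<and>
              (b < 0 \<longrightarrow> optimal up) \<and>
              (b = 0 \<longrightarrow> (\<forall>d \<in> {low..up}. optimal d))) \<and>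
           (a > 0 \<longrightarrow>
              (sym < low \<longrightarrow> optimal low) \<and>
              (sym > up \<longrightarrow> optimal up) \<and>
              (low \<le> sym \<and> sym \<le> up \<longrightarrow> optimal sym)) \<and>
           (a < 0 \<longrightarrow>
              (sym < low \<longrightarrow> optimal up) \<and>
              (sym > up \<longrightarrow> optimal low) \<and>
              (low \<le> sym \<and> sym \<le> up \<longrightarrow>
                 (\<exists>d. optimal_solution f {low, up} d) \<and>
                 (\<forall>d. optimal_solution f {low, up} d \<longrightarrow> optimal d)))"
proof -
  consider "a = 0" | "a > 0" | "a < 0"
    by linarith
  then show ?thesis
  proof cases
    case 1
    \<comment> \<open>No axis here: the objective is linear, so the bounds on a feasible point are
      multiplied by \<open>b\<close> according to its sign.\<close>
    with assms show ?thesis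
      by (auto simp: Let_def is_arg_min_linorder objective_def
          mult_left_mono mult_left_mono_neg)
  next
    case 2
    with assms show ?thesis
      by (auto simp: Let_def is_arg_min_linorder objective_le_iff_pos)
  next
    case 3
    \<comment> \<open>Ensures that the claim about every best endpoint is not vacuous.\<close>
    have "\<exists>d. optimal_solution (objective a b c) {low, up} d"
      using ex_is_arg_min_if_finite[of "{low, up}" "objective a b c"] by simp
    \<comment> \<open>With the axis inside the interval, no feasible point is farther from it than
      the farther endpoint, which is what a best endpoint is.\<close>
    with 3 assms show ?thesis
      by (auto simp: Let_def is_arg_min_linorder objective_le_iff_neg)
  qed
qed

end
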